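(* Let $X$ be a rearrangement invariant space on $\Omega$, where $\Omega=(0,1)$ or $\Omega=(0,\infty)$, with the Fatou property. Then for every $f\in X$, $$\operatorname{dist}_X(f^*,X_a)=\operatorname{dist}_X(f,X_a).$$
   Context: A rearrangement invariant space on $\Omega$ (Lebesgue measure) is a Banach space $X\subset L_0(\Omega)$ such that $|f|\le|g|$ a.e., $g\in X$ imply $f\in X$, $\|f\|_X\le\|g\|_X$, containing an a.e. positive function, and such that whenever $f\in X$ and $g$ has the same distribution function as $f$ ($d_f(\lambda)=m\{|f|>\lambda\}$), then $g\in X$ and $\|g\|_X=\|f\|_X$. Fatou property: if $0\le f_n\uparrow f$ a.e., $f_n\in X$, $\sup_n\|f_n\|_X<\infty$, then $f\in X$ and $\|f_n\|_X\uparrow\|f\|_X$. $f^*(t)=\inf\{\lambda>0:d_f(\lambda)\le t\}$ is the non-increasing rearrangement (regarded as a function on $\Omega$). $X_a$ is the ideal of order continuous elements: $f\in X_a$ iff for every sequence $0\le f_n\le|f|$ with $f_n\downarrow0$ a.e. one has $\|f_n\|_X\to0$. $\operatorname{dist}_X(h,X_a)=\inf\{\|h-g\|_X:g\in X_a\}$. *)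

theory Defs
  imports "HOL-Analysis.Analysis"
begin

abbreviation Leb :: "real set \<Rightarrow> real measure" where
  "Leb \<Omega> \<equiv> restrict_space lebesgue \<Omega>"

text \<open>L_0(\<Omega>): (Lebesgue) measurable real functions on \<Omega>; values outside \<Omega> are irrelevant.\<close>
definition L0 :: "real set \<Rightarrow> (real \<Rightarrow> real) set" where
  "L0 \<Omega> = borel_measurable (Leb \<Omega>)"

definition distrib_fun :: "real set \<Rightarrow> (real \<Rightarrow> real) \<Rightarrow> real \<Rightarrow> ennreal" where
  "distrib_fun \<Omega> f s = emeasure (Leb \<Omega>) {x \<in> \<Omega>. s < \<bar>f x\<bar>}"

definition decr_rearr :: "real set \<Rightarrow> (real \<Rightarrow> real) \<Rightarrow> real \<Rightarrow> real" where
  "decr_rearr \<Omega> f t = Inf {s. 0 < s \<and> distrib_fun \<Omega> f s \<le> ennreal t}"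

definition ri_space :: "real set \<Rightarrow> (real \<Rightarrow> real) set \<Rightarrow> ((real \<Rightarrow> real) \<Rightarrow> real) \<Rightarrow> bool" where
  "ri_space \<Omega> X nrm \<longleftrightarrow>
     X \<subseteq> L0 \<Omega> \<and>
     \<comment> \<open>linear space\<close>
     (\<lambda>x. 0) \<in> X \<and>
     (\<forall>f\<in>X. \<forall>g\<in>X. (\<lambda>x. f x + g x) \<in> X) \<and>
     (\<forall>f\<in>X. \<forall>c::real. (\<lambda>x. c * f x) \<in> X) \<and>
     \<comment> \<open>norm (on a.e.-equivalence classes)\<close>
     (\<forall>f\<in>X. 0 \<le> nrm f) \<and>
     (\<forall>f\<in>X. nrm f = 0 \<longleftrightarrow> (AE x in Leb \<Omega>. f x = 0)) \<and>
     (\<forall>f\<in>X. \<forall>g\<in>X. nrm (\<lambda>x. f x + g x) \<le> nrm f + nrm g) \<and>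
     (\<forall>f\<in>X. \<forall>c::real. nrm (\<lambda>x. c * f x) = \<bar>c\<bar> * nrm f) \<and>
     \<comment> \<open>completeness (Banach space)\<close>
     (\<forall>u::nat \<Rightarrow> real \<Rightarrow> real. (\<forall>n. u n \<in> X) \<and>
         (\<forall>e>0. \<exists>N. \<forall>m\<ge>N. \<forall>n\<ge>N. nrm (\<lambda>x. u m x - u n x) < e)
        \<longrightarrow> (\<exists>v\<in>X. (\<lambda>n. nrm (\<lambda>x. u n x - v x)) \<longlonglongrightarrow> 0)) \<and>
     \<comment> \<open>ideal / lattice property\<close>
     (\<forall>f\<in>L0 \<Omega>. \<forall>g\<in>X. (AE x in Leb \<Omega>. \<bar>f x\<bar> \<le> \<bar>g x\<bar>) \<longrightarrow> f \<in> X \<and> nrm f \<le> nrm g) \<and>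
     \<comment> \<open>contains an a.e. positive function\<close>
     (\<exists>w\<in>X. AE x in Leb \<Omega>. 0 < w x) \<and>
     \<comment> \<open>rearrangement invariance\<close>
     (\<forall>f\<in>X. \<forall>g\<in>L0 \<Omega>. distrib_fun \<Omega> g = distrib_fun \<Omega> f \<longrightarrow> g \<in> X \<and> nrm g = nrm f)"

definition fatou_property :: "real set \<Rightarrow> (real \<Rightarrow> real) set \<Rightarrow> ((real \<Rightarrow> real) \<Rightarrow> real) \<Rightarrow> bool" where
  "fatou_property \<Omega> X nrm \<longleftrightarrow>
     (\<forall>fs::nat \<Rightarrow> real \<Rightarrow> real. \<forall>f\<in>L0 \<Omega>.
        (\<forall>n. fs n \<in> X) \<and>
        (AE x in Leb \<Omega>. \<forall>n. 0 \<le> fs n x \<and> fs n x \<le> fs (Suc n) x) \<and>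
        (AE x in Leb \<Omega>. (\<lambda>n. fs n x) \<longlonglongrightarrow> f x) \<and>
        bdd_above (range (\<lambda>n. nrm (fs n)))
      \<longrightarrow> f \<in> X \<and> (\<lambda>n. nrm (fs n)) \<longlonglongrightarrow> nrm f)"

definition order_cont_part :: "real set \<Rightarrow> (real \<Rightarrow> real) set \<Rightarrow> ((real \<Rightarrow> real) \<Rightarrow> real) \<Rightarrow> (real \<Rightarrow> real) set" where
  "order_cont_part \<Omega> X nrm =
     {f \<in> X. \<forall>fs::nat \<Rightarrow> real \<Rightarrow> real.
        (\<forall>n. fs n \<in> L0 \<Omega>) \<and>
        (AE x in Leb \<Omega>. \<forall>n. 0 \<le> fs n x \<and> fs n x \<le> \<bar>f x\<bar> \<and> fs (Suc n) x \<le> fs n x) \<and>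
        (AE x in Leb \<Omega>. (\<lambda>n. fs n x) \<longlonglongrightarrow> 0)
      \<longrightarrow> (\<lambda>n. nrm (fs n)) \<longlonglongrightarrow> 0}"

definition dist_Xa :: "real set \<Rightarrow> (real \<Rightarrow> real) set \<Rightarrow> ((real \<Rightarrow> real) \<Rightarrow> real) \<Rightarrow> (real \<Rightarrow> real) \<Rightarrow> real" where
  "dist_Xa \<Omega> X nrm h = Inf {nrm (\<lambda>x. h x - g x) | g. g \<in> order_cont_part \<Omega> X nrm}"

end

theory Submission
  imports Defs
begin

text \<open>Both sides depend only on the distribution function. If \<open>X\<^sub>a \<noteq> {0}\<close>, indicators of sets of
  small measure have small norm, so the part of \<open>f\<close> with values in \<open>a < \<bar>f\<bar> \<le> b\<close> lies in \<open>X\<^sub>a\<close> as soon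
  as \<open>d\<^sub>f(a) < \<infinity>\<close>. Conversely, restricting \<open>f - g\<close>, for \<open>g \<in> X\<^sub>a\<close>, to sets decreasing to the empty
  set shows that the infimum over \<open>a, b\<close> of the norms of the remaining parts of \<open>f\<close> is at most
  \<open>\<parallel>f - g\<parallel>\<close>. Hence the distance equals this infimum, and the distribution function of the
  remaining part is determined by \<open>d\<^sub>f\<close>, \<open>a\<close> and \<open>b\<close>.\<close>

section \<open>Distribution functions\<close>

lemma L0_sets:
  assumes "f \<in> L0 \<Omega>"
  shows "{x \<in> \<Omega>. s < \<bar>f x\<bar>} \<in> sets (Leb \<Omega>)"
proof -
  have [measurable]: "f \<in> borel_measurable (Leb \<Omega>)" using assms by (simp add: L0_def)
  have "{x \<in> space (Leb \<Omega>). s < \<bar>f x\<bar>} \<in> sets (Leb \<Omega>)" by measurable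
  then show ?thesis by (simp add: space_restrict_space)
qed

lemma distrib_fun_antimono:
  assumes "f \<in> L0 \<Omega>" "s \<le> s'"
  shows "distrib_fun \<Omega> f s' \<le> distrib_fun \<Omega> f s"
  unfolding distrib_fun_def using assms by (intro emeasure_mono L0_sets) auto

lemma distrib_fun_neg:
  assumes "s < 0"
  shows "distrib_fun \<Omega> f s = emeasure (Leb \<Omega>) \<Omega>"
proof -
  have "{x \<in> \<Omega>. s < \<bar>f x\<bar>} = \<Omega>" using assms by (auto intro: less_le_trans)
  then show ?thesis by (simp add: distrib_fun_def)
qed

text \<open>Continuity of the measure from above, legitimate because the level set at
  \<open>s\<close> has finite measure; since \<open>f\<close> is real valued, the intersection is
  empty.\<close>

lemma distrib_fun_tendsto_0:
  assumes f: "f \<in> L0 \<Omega>" and fin: "distrib_fun \<Omega> f s < \<infinity>"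
  shows "(\<lambda>n. distrib_fun \<Omega> f (s + real n)) \<longlonglongrightarrow> 0"
proof -
  have "(\<lambda>n. emeasure (Leb \<Omega>) {x \<in> \<Omega>. s + real n < \<bar>f x\<bar>})
      \<longlonglongrightarrow> emeasure (Leb \<Omega>) (\<Inter>n. {x \<in> \<Omega>. s + real n < \<bar>f x\<bar>})"
  proof (rule Lim_emeasure_decseq)
    show "range (\<lambda>n. {x \<in> \<Omega>. s + real n < \<bar>f x\<bar>}) \<subseteq> sets (Leb \<Omega>)"
      using L0_sets[OF f] by auto
    show "decseq (\<lambda>n. {x \<in> \<Omega>. s + real n < \<bar>f x\<bar>})"
      by (auto simp: decseq_def)
    fix n
    show "emeasure (Leb \<Omega>) {x \<in> \<Omega>. s + real n < \<bar>f x\<bar>} \<noteq> \<infinity>"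
      using fin distrib_fun_antimono[OF f, of s "s + real n"]
      by (auto simp: distrib_fun_def top_unique)
  qed
  moreover have "(\<Inter>n. {x \<in> \<Omega>. s + real n < \<bar>f x\<bar>}) = {}"
  proof -
    have "\<exists>n. \<not> s + real n < \<bar>f x\<bar>" for x
      using reals_Archimedean2[of "\<bar>f x\<bar> - s"] by (metis add.commute diff_less_eq less_asym)
    then show ?thesis by fastforce
  qed
  ultimately show ?thesis by (simp add: distrib_fun_def)
qed

text \<open>Right continuity of the distribution function, from continuity of the measure from below
  along the levels \<open>s + 1 / real (Suc n)\<close>.\<close>

lemma distrib_fun_right_cont:
  assumes f: "f \<in> L0 \<Omega>" and t: "t < distrib_fun \<Omega> f s"
  shows "\<exists>s'>s. t < distrib_fun \<Omega> f s'"
proof -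
  have "(\<lambda>n. emeasure (Leb \<Omega>) {x \<in> \<Omega>. s + 1 / real (Suc n) < \<bar>f x\<bar>})
      \<longlonglongrightarrow> emeasure (Leb \<Omega>) (\<Union>n. {x \<in> \<Omega>. s + 1 / real (Suc n) < \<bar>f x\<bar>})"
  proof (rule Lim_emeasure_incseq)
    show "range (\<lambda>n. {x \<in> \<Omega>. s + 1 / real (Suc n) < \<bar>f x\<bar>}) \<subseteq> sets (Leb \<Omega>)"
      using L0_sets[OF f] by auto
    have "1 / real (Suc n) \<le> 1 / real (Suc m)" if "m \<le> n" for m n
      using that by (simp add: frac_le)
    then show "incseq (\<lambda>n. {x \<in> \<Omega>. s + 1 / real (Suc n) < \<bar>f x\<bar>})"
      by (force simp: incseq_def)
  qed
  moreover have "(\<Union>n. {x \<in> \<Omega>. s + 1 / real (Suc n) < \<bar>f x\<bar>}) = {x \<in> \<Omega>. s < \<bar>f x\<bar>}" (is "?l = ?r")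
  proof
    show "?l \<subseteq> ?r" by (auto intro: less_trans[rotated])
    show "?r \<subseteq> ?l"
    proof
      fix x assume x: "x \<in> ?r"
      then have "0 < \<bar>f x\<bar> - s" by simp
      then obtain n where "1 / real (Suc n) < \<bar>f x\<bar> - s"
        using nat_approx_posE by blast
      then have "s + 1 / real (Suc n) < \<bar>f x\<bar>" by linarith
      then show "x \<in> ?l" using x by blast
    qed
  qed
  ultimately have "(\<lambda>n. distrib_fun \<Omega> f (s + 1 / real (Suc n))) \<longlonglongrightarrow> distrib_fun \<Omega> f s"
    by (simp add: distrib_fun_def)
  from order_tendstoD(1)[OF this t] obtain n where "t < distrib_fun \<Omega> f (s + 1 / real (Suc n))"
    by (auto simp: eventually_sequentially)
  then show ?thesis by (intro exI[of _ "s + 1 / real (Suc n)"]) auto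
qed

section \<open>The non-increasing rearrangement and its equimeasurability\<close>

text \<open>The rearrangement is a generalized inverse of the distribution function. The finiteness
  hypothesis makes the set under \<open>Inf\<close> nonempty for every \<open>t > 0\<close>; right
  continuity makes the inequality on the left strict.\<close>

lemma less_decr_rearr_iff:
  assumes f: "f \<in> L0 \<Omega>" and fin: "\<exists>s. distrib_fun \<Omega> f s < \<infinity>" and t: "0 < t" and s: "0 \<le> s"
  shows "s < decr_rearr \<Omega> f t \<longleftrightarrow> ennreal t < distrib_fun \<Omega> f s"
proof -
  define S where "S = {s. 0 < s \<and> distrib_fun \<Omega> f s \<le> ennreal t}"
  have bdd: "bdd_below S" by (rule bdd_belowI[of _ 0]) (auto simp: S_def)
  obtain s0 where "distrib_fun \<Omega> f s0 < \<infinity>" using fin by blast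
  then have "(\<lambda>n. distrib_fun \<Omega> f (s0 + real n)) \<longlonglongrightarrow> 0"
    by (rule distrib_fun_tendsto_0[OF f])
  from order_tendstoD(2)[OF this, of "ennreal t"] t
  obtain n where "distrib_fun \<Omega> f (s0 + real n) < ennreal t"
    by (auto simp: eventually_sequentially)
  then have "distrib_fun \<Omega> f (max 1 (s0 + real n)) \<le> ennreal t"
    using distrib_fun_antimono[OF f, of "s0 + real n" "max 1 (s0 + real n)"] by auto
  then have "max 1 (s0 + real n) \<in> S" by (auto simp: S_def)
  then have ne: "S \<noteq> {}" by blast
  \<comment> \<open>The level \<open>s\<close> may be 0 and then lies outside \<open>S\<close>, so
    the bound is reached through \<open>s + e\<close>.\<close>
  have "Inf S \<le> s" if le: "distrib_fun \<Omega> f s \<le> ennreal t"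
  proof (rule field_le_epsilon)
    fix e :: real assume "0 < e"
    then have "distrib_fun \<Omega> f (s + e) \<le> ennreal t"
      using distrib_fun_antimono[OF f, of s "s + e"] le by auto
    then have "s + e \<in> S" using s \<open>0 < e\<close> by (auto simp: S_def)
    then show "Inf S \<le> s + e" using bdd by (rule cInf_lower)
  qed
  moreover have "s < Inf S" if "ennreal t < distrib_fun \<Omega> f s"
  proof -
    obtain s' where s': "s' > s" "ennreal t < distrib_fun \<Omega> f s'"
      using distrib_fun_right_cont[OF f \<open>ennreal t < distrib_fun \<Omega> f s\<close>] by blast
    have "s' \<le> Inf S"
    proof (rule cInf_greatest[OF ne], rule ccontr)
      fix u assume "u \<in> S" "\<not> s' \<le> u"
      then have "distrib_fun \<Omega> f s' \<le> ennreal t"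
        using distrib_fun_antimono[OF f, of u s'] by (auto simp: S_def)
      then show False using s' by auto
    qed
    then show ?thesis using s' by auto
  qed
  ultimately show ?thesis unfolding decr_rearr_def S_def[symmetric] by (meson not_less)
qed

text \<open>The set is all of \<open>\<Omega>\<close> if \<open>D\<close> is infinite and an open
  interval of length \<open>D\<close> starting at 0 otherwise; the bound on \<open>D\<close> keeps
  this interval inside \<open>\<Omega>\<close>.\<close>

lemma emeasure_initial_segment:
  assumes \<Omega>: "\<Omega> = {0<..<1::real} \<or> \<Omega> = {0<..}" and D: "D \<le> emeasure (Leb \<Omega>) \<Omega>"
  shows "emeasure (Leb \<Omega>) {t \<in> \<Omega>. ennreal t < D} = D" "{t \<in> \<Omega>. ennreal t < D} \<in> sets (Leb \<Omega>)"
proof -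
  have \<Omega>_sets: "\<Omega> \<in> sets lebesgue" using \<Omega> by auto
  have eq: "{t \<in> \<Omega>. ennreal t < D} = (if D = \<infinity> then \<Omega> else {0<..<enn2real D})"
  proof (cases D)
    case (real r)
    have "r \<le> 1" if "\<Omega> = {0<..<1}"
      using D that real by (simp add: emeasure_restrict_space)
    then show ?thesis using \<Omega> real
      by (auto simp: ennreal_less_iff)
  qed auto
  show "{t \<in> \<Omega>. ennreal t < D} \<in> sets (Leb \<Omega>)"
  proof -
    have "{t \<in> \<Omega>. ennreal t < D} \<in> sets lebesgue" using \<Omega>_sets unfolding eq by auto
    then show ?thesis using \<Omega>_sets by (auto simp: sets_restrict_space_iff)
  qed
  show "emeasure (Leb \<Omega>) {t \<in> \<Omega>. ennreal t < D} = D"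
  proof (cases "D = \<infinity>")
    case True
    then show ?thesis using D by (auto simp: top_unique)
  next
    case False
    then have "{t \<in> \<Omega>. ennreal t < D} = {0<..<enn2real D}" using eq by simp
    then show ?thesis using False \<Omega>_sets
      by (subst emeasure_restrict_space) (auto simp: less_top)
  qed
qed

text \<open>By \<open>less_decr_rearr_iff\<close>, the level set of the rearrangement at height
  \<open>s\<close> is the initial segment of \<open>\<Omega>\<close> of length
  \<open>distrib_fun \<Omega> f s\<close>.\<close>

lemma decr_rearr_equimeasurable:
  assumes \<Omega>: "\<Omega> = {0<..<1} \<or> \<Omega> = {0<..}"
    and f: "f \<in> L0 \<Omega>" and fin: "\<exists>s. distrib_fun \<Omega> f s < \<infinity>"
  shows "decr_rearr \<Omega> f \<in> L0 \<Omega>" "distrib_fun \<Omega> (decr_rearr \<Omega> f) = distrib_fun \<Omega> f"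
    and "t \<in> \<Omega> \<Longrightarrow> 0 \<le> decr_rearr \<Omega> f t"
proof -
  have pos: "0 < t" if "t \<in> \<Omega>" for t using \<Omega> that by auto
  note iff = less_decr_rearr_iff[OF f fin pos]
  show nonneg: "0 \<le> decr_rearr \<Omega> f t" if t: "t \<in> \<Omega>" for t
  proof -
    \<comment> \<open>\<open>Inf\<close> of the empty set has no known sign. If the rearrangement is
      not positive at \<open>t\<close>, the equivalence at height 0 puts 1 into the set.\<close>
    have "{s. 0 < s \<and> distrib_fun \<Omega> f s \<le> ennreal t} \<noteq> {} \<or> 0 < decr_rearr \<Omega> f t"
    proof (rule ccontr)
      assume *: "\<not> ?thesis"
      then have "\<not> 0 < decr_rearr \<Omega> f t" by simp
      then have "distrib_fun \<Omega> f 0 \<le> ennreal t" using iff[OF t, of 0] by simp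
      then have "distrib_fun \<Omega> f 1 \<le> ennreal t" using distrib_fun_antimono[OF f, of 0 1] by auto
      then show False using * by (metis (mono_tags, lifting) empty_Collect_eq zero_less_one)
    qed
    then show ?thesis
      by (metis (mono_tags, lifting) cInf_greatest decr_rearr_def less_eq_real_def mem_Collect_eq)
  qed
  have D: "distrib_fun \<Omega> f s \<le> emeasure (Leb \<Omega>) \<Omega>" for s
    unfolding distrib_fun_def
    using sets.top[of "Leb \<Omega>"] by (intro emeasure_mono) (auto simp: space_restrict_space)
  have set_eq: "{t \<in> \<Omega>. s < \<bar>decr_rearr \<Omega> f t\<bar>} = {t \<in> \<Omega>. ennreal t < distrib_fun \<Omega> f s}"
    if "0 \<le> s" for s
    using iff[OF _ that] nonneg by auto
  show "distrib_fun \<Omega> (decr_rearr \<Omega> f) = distrib_fun \<Omega> f"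
  proof
    fix s show "distrib_fun \<Omega> (decr_rearr \<Omega> f) s = distrib_fun \<Omega> f s"
    proof (cases "s < 0")
      case True
      then show ?thesis by (simp add: distrib_fun_neg)
    next
      case False
      then show ?thesis
        using emeasure_initial_segment(1)[OF \<Omega> D[of s]] set_eq[of s]
        by (simp add: distrib_fun_def[of \<Omega> "decr_rearr \<Omega> f"])
    qed
  qed
  show "decr_rearr \<Omega> f \<in> L0 \<Omega>"
    unfolding L0_def
  proof (rule borel_measurable_iff_greater[THEN iffD2], rule allI)
    fix s
    show "{t \<in> space (Leb \<Omega>). s < decr_rearr \<Omega> f t} \<in> sets (Leb \<Omega>)"
    proof (cases "s < 0")
      case True
      then have "{t \<in> space (Leb \<Omega>). s < decr_rearr \<Omega> f t} = space (Leb \<Omega>)"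
        using nonneg by (force simp: space_restrict_space)
      then show ?thesis by simp
    next
      case False
      then have "{t \<in> space (Leb \<Omega>). s < decr_rearr \<Omega> f t}
          = {t \<in> \<Omega>. s < \<bar>decr_rearr \<Omega> f t\<bar>}"
        using nonneg by (auto simp: space_restrict_space)
      then show ?thesis
        using emeasure_initial_segment(2)[OF \<Omega> D[of s]] set_eq[of s] False by simp
    qed
  qed
qed

section \<open>Removing a layer of values\<close>

text \<open>The layer is half-open to match the strict inequality in \<open>distrib_fun\<close>: it
  is then a difference of two level sets.\<close>

definition cut :: "real \<Rightarrow> real \<Rightarrow> (real \<Rightarrow> real) \<Rightarrow> real \<Rightarrow> real" where
  "cut a b h x = (if a < \<bar>h x\<bar> \<and> \<bar>h x\<bar> \<le> b then 0 else h x)"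

lemma cut_L0:
  assumes "h \<in> L0 \<Omega>"
  shows "cut a b h \<in> L0 \<Omega>"
proof -
  have [measurable]: "h \<in> borel_measurable (Leb \<Omega>)" using assms by (simp add: L0_def)
  show ?thesis unfolding L0_def cut_def by measurable
qed

text \<open>Below \<open>a\<close>, the level set splits into the disjoint pieces
  \<open>\<bar>h x\<bar> > b\<close> and \<open>s < \<bar>h x\<bar> \<le> a\<close>; finiteness at
  \<open>a\<close> permits subtracting measures. From \<open>a\<close> on, only values above
  \<open>b\<close> survive. The formula sees \<open>h\<close> only through its distribution
  function.\<close>

lemma distrib_fun_cut:
  assumes h: "h \<in> L0 \<Omega>" and ab: "0 \<le> a" "a \<le> b" and fin: "distrib_fun \<Omega> h a < \<infinity>" and s: "0 \<le> s"
  shows "distrib_fun \<Omega> (cut a b h) s =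
    distrib_fun \<Omega> h (max s b) + (if s < a then distrib_fun \<Omega> h s - distrib_fun \<Omega> h a else 0)"
proof (cases "s < a")
  case True
  let ?L = "\<lambda>s. {x \<in> \<Omega>. s < \<bar>h x\<bar>}"
  have "{x \<in> \<Omega>. s < \<bar>cut a b h x\<bar>} = ?L b \<union> (?L s - ?L a)"
    using ab True s by (auto simp: cut_def)
  moreover have "emeasure (Leb \<Omega>) (?L b \<union> (?L s - ?L a)) =
      emeasure (Leb \<Omega>) (?L b) + emeasure (Leb \<Omega>) (?L s - ?L a)"
    using ab L0_sets[OF h] by (intro plus_emeasure[symmetric]) auto
  moreover have "emeasure (Leb \<Omega>) (?L s - ?L a) = emeasure (Leb \<Omega>) (?L s) - emeasure (Leb \<Omega>) (?L a)"
    using fin True L0_sets[OF h] by (intro emeasure_Diff) (auto simp: distrib_fun_def)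
  ultimately show ?thesis using True ab by (simp add: distrib_fun_def max_def)
next
  case False
  then have "{x \<in> \<Omega>. s < \<bar>cut a b h x\<bar>} = {x \<in> \<Omega>. max s b < \<bar>h x\<bar>}"
    using ab s by (auto simp: cut_def)
  then show ?thesis using False by (simp add: distrib_fun_def)
qed

lemma distrib_fun_cut_cong:
  assumes "f \<in> L0 \<Omega>" "g \<in> L0 \<Omega>" "distrib_fun \<Omega> f = distrib_fun \<Omega> g"
    and "0 \<le> a" "a \<le> b" "distrib_fun \<Omega> f a < \<infinity>"
  shows "distrib_fun \<Omega> (cut a b f) = distrib_fun \<Omega> (cut a b g)"
proof
  fix s
  show "distrib_fun \<Omega> (cut a b f) s = distrib_fun \<Omega> (cut a b g) s"
    using assms distrib_fun_cut[of f \<Omega> a b s] distrib_fun_cut[of g \<Omega> a b s]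
    by (cases "s < 0") (auto simp: distrib_fun_neg)
qed

lemma distrib_fun_scale:
  assumes "0 < c"
  shows "distrib_fun \<Omega> (\<lambda>x. c * f x) s = distrib_fun \<Omega> f (s / c)"
proof -
  have "{x \<in> \<Omega>. s < \<bar>c * f x\<bar>} = {x \<in> \<Omega>. s / c < \<bar>f x\<bar>}"
    using assms by (auto simp: abs_mult divide_simps mult.commute)
  then show ?thesis by (simp add: distrib_fun_def)
qed

lemma distrib_fun_indicator:
  assumes "A \<subseteq> \<Omega>"
  shows "distrib_fun \<Omega> (indicator A) s =
    (if s < 0 then emeasure (Leb \<Omega>) \<Omega> else if s < 1 then emeasure (Leb \<Omega>) A else 0)"
proof -
  have "{x \<in> \<Omega>. s < \<bar>indicator A x :: real\<bar>} = (if s < 0 then \<Omega> else if s < 1 then A else {})"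
    using assms by (auto simp: indicator_def split: if_splits)
  then show ?thesis by (simp add: distrib_fun_def)
qed

section \<open>Rearrangement invariant spaces\<close>

locale ri_function_space =
  fixes \<Omega> :: "real set" and X :: "(real \<Rightarrow> real) set" and nrm :: "(real \<Rightarrow> real) \<Rightarrow> real"
  assumes Omega: "\<Omega> = {0<..<1} \<or> \<Omega> = {0<..}"
    and ri: "ri_space \<Omega> X nrm"
begin

abbreviation (input) "Xa \<equiv> order_cont_part \<Omega> X nrm"

lemma
  shows in_L0: "f \<in> X \<Longrightarrow> f \<in> L0 \<Omega>"
    and zero_in: "(\<lambda>x. 0) \<in> X"
    and add_in: "f \<in> X \<Longrightarrow> g \<in> X \<Longrightarrow> (\<lambda>x. f x + g x) \<in> X"
    and scale_in: "f \<in> X \<Longrightarrow> (\<lambda>x. c * f x) \<in> X"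
    and norm_nonneg: "f \<in> X \<Longrightarrow> 0 \<le> nrm f"
    and norm_eq_0: "f \<in> X \<Longrightarrow> nrm f = 0 \<longleftrightarrow> (AE x in Leb \<Omega>. f x = 0)"
    and norm_triangle: "f \<in> X \<Longrightarrow> g \<in> X \<Longrightarrow> nrm (\<lambda>x. f x + g x) \<le> nrm f + nrm g"
    and norm_scale: "f \<in> X \<Longrightarrow> nrm (\<lambda>x. c * f x) = \<bar>c\<bar> * nrm f"
    and ideal_in: "f \<in> L0 \<Omega> \<Longrightarrow> g \<in> X \<Longrightarrow> AE x in Leb \<Omega>. \<bar>f x\<bar> \<le> \<bar>g x\<bar> \<Longrightarrow> f \<in> X"
    and norm_le: "f \<in> L0 \<Omega> \<Longrightarrow> g \<in> X \<Longrightarrow> AE x in Leb \<Omega>. \<bar>f x\<bar> \<le> \<bar>g x\<bar> \<Longrightarrow> nrm f \<le> nrm g"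
    and equi_in: "f \<in> X \<Longrightarrow> g \<in> L0 \<Omega> \<Longrightarrow> distrib_fun \<Omega> g = distrib_fun \<Omega> f \<Longrightarrow> g \<in> X"
    and equi_norm: "f \<in> X \<Longrightarrow> g \<in> L0 \<Omega> \<Longrightarrow> distrib_fun \<Omega> g = distrib_fun \<Omega> f \<Longrightarrow> nrm g = nrm f"
  using ri unfolding ri_space_def by blast+

lemma Omega_sets: "\<Omega> \<in> sets lebesgue"
  using Omega by auto

lemma space_Leb [simp]: "space (Leb \<Omega>) = \<Omega>"
  by (simp add: space_restrict_space)

lemma id_measurable: "(\<lambda>x. x) \<in> borel_measurable (Leb \<Omega>)"
  by (intro measurable_restrict_space1 measurable_completion) simp

lemma diff_in:
  assumes "f \<in> X" "g \<in> X"
  shows "(\<lambda>x. f x - g x) \<in> X"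
  using add_in[OF assms(1) scale_in[OF assms(2), of "-1"]] by simp

lemma norm_cong:
  assumes "f \<in> L0 \<Omega>" "g \<in> X" "AE x in Leb \<Omega>. \<bar>f x\<bar> = \<bar>g x\<bar>"
  shows "nrm f = nrm g"
proof (rule antisym)
  have *: "AE x in Leb \<Omega>. \<bar>f x\<bar> \<le> \<bar>g x\<bar>" "AE x in Leb \<Omega>. \<bar>g x\<bar> \<le> \<bar>f x\<bar>"
    using assms(3) by auto
  show "nrm f \<le> nrm g" using assms * by (intro norm_le)
  show "nrm g \<le> nrm f" using assms * by (intro norm_le[OF in_L0 ideal_in]) auto
qed

lemma mult_indicator_L0:
  assumes "f \<in> L0 \<Omega>" "E \<in> sets (Leb \<Omega>)"
  shows "(\<lambda>x. f x * indicator E x) \<in> L0 \<Omega>"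
  using assms by (simp add: L0_def)

lemma indicator_L0: "E \<in> sets (Leb \<Omega>) \<Longrightarrow> indicator E \<in> L0 \<Omega>"
  by (simp add: L0_def)

lemma mult_indicator_in:
  assumes "f \<in> X" "E \<in> sets (Leb \<Omega>)"
  shows "(\<lambda>x. f x * indicator E x) \<in> X" "nrm (\<lambda>x. f x * indicator E x) \<le> nrm f"
proof -
  have "AE x in Leb \<Omega>. \<bar>f x * indicator E x\<bar> \<le> \<bar>f x\<bar>"
    by (rule AE_I2) (auto simp: indicator_def)
  then show "(\<lambda>x. f x * indicator E x) \<in> X" "nrm (\<lambda>x. f x * indicator E x) \<le> nrm f"
    using mult_indicator_L0[OF in_L0[OF assms(1)] assms(2)] assms(1) ideal_in norm_le by blast+
qed

text \<open>Split \<open>h\<close> as \<open>(h - g) + g\<close> on \<open>E\<close>. For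
  \<open>g\<close> in \<open>Xa\<close> and \<open>E\<close> shrinking to the empty set the last
  term vanishes, which yields lower bounds for the distance.\<close>

lemma norm_restrict_le:
  assumes "h \<in> X" "g \<in> X" "E \<in> sets (Leb \<Omega>)"
  shows "nrm (\<lambda>x. h x * indicator E x) \<le> nrm (\<lambda>x. h x - g x) + nrm (\<lambda>x. g x * indicator E x)"
proof -
  have "nrm (\<lambda>x. h x * indicator E x)
      = nrm (\<lambda>x. (h x - g x) * indicator E x + g x * indicator E x)"
    by (simp add: algebra_simps)
  also have "\<dots> \<le> nrm (\<lambda>x. (h x - g x) * indicator E x) + nrm (\<lambda>x. g x * indicator E x)"
    using assms by (intro norm_triangle mult_indicator_in diff_in)
  also have "nrm (\<lambda>x. (h x - g x) * indicator E x) \<le> nrm (\<lambda>x. h x - g x)"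
    using assms by (intro mult_indicator_in diff_in)
  finally show ?thesis by simp
qed

text \<open>Otherwise \<open>f\<close> and \<open>2 f\<close> would be equimeasurable, so that \<open>\<parallel>f\<parallel> = 2 \<parallel>f\<parallel>\<close>.\<close>
lemma distrib_fun_finite:
  assumes f: "f \<in> X"
  shows "\<exists>s. distrib_fun \<Omega> f s < \<infinity>"
proof (rule ccontr)
  assume "\<not> ?thesis"
  then have inf: "distrib_fun \<Omega> f s = \<infinity>" for s by (simp add: not_less top_unique)
  have f2: "(\<lambda>x. 2 * f x) \<in> X" using f by (rule scale_in)
  have "distrib_fun \<Omega> (\<lambda>x. 2 * f x) = distrib_fun \<Omega> f"
    using inf by (auto simp: distrib_fun_scale)
  then have "nrm (\<lambda>x. 2 * f x) = nrm f" by (intro equi_norm[OF f] in_L0 f2)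
  then have "nrm f = 0" using norm_scale[OF f, of 2] by simp
  then have "AE x in Leb \<Omega>. f x = 0" using norm_eq_0[OF f] by simp
  then have "AE x in Leb \<Omega>. \<not> 0 < \<bar>f x\<bar>" by auto
  then have "emeasure (Leb \<Omega>) {x \<in> space (Leb \<Omega>). 0 < \<bar>f x\<bar>} = 0"
    using L0_sets[OF in_L0[OF f], of 0] by (subst (asm) AE_iff_measurable[OF _ refl]) auto
  then show False using inf[of 0] by (simp add: distrib_fun_def)
qed

lemma decr_rearr_in:
  assumes "f \<in> X"
  shows "decr_rearr \<Omega> f \<in> X" "nrm (decr_rearr \<Omega> f) = nrm f"
  using decr_rearr_equimeasurable[OF Omega in_L0 distrib_fun_finite, OF assms assms]
    equi_in equi_norm assms by blast+

text \<open>Passing to rearrangements turns the comparison of distribution functions into a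
  pointwise one, to which the ideal property applies.\<close>

lemma distrib_fun_mono:
  assumes h: "h \<in> X" and g: "g \<in> L0 \<Omega>" and le: "\<And>s. distrib_fun \<Omega> g s \<le> distrib_fun \<Omega> h s"
  shows "g \<in> X" "nrm g \<le> nrm h"
proof -
  obtain s where "distrib_fun \<Omega> h s < \<infinity>" using distrib_fun_finite[OF h] by blast
  then have gfin: "\<exists>s. distrib_fun \<Omega> g s < \<infinity>" using le[of s] by (meson le_less_trans)
  note g' = decr_rearr_equimeasurable[OF Omega g gfin]
  note h' = decr_rearr_equimeasurable[OF Omega in_L0[OF h] distrib_fun_finite[OF h]]
  have "AE t in Leb \<Omega>. \<bar>decr_rearr \<Omega> g t\<bar> \<le> \<bar>decr_rearr \<Omega> h t\<bar>"
  proof (rule AE_I2)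
    fix t assume "t \<in> space (Leb \<Omega>)"
    then have t: "t \<in> \<Omega>" "0 < t" using Omega by auto
    have "decr_rearr \<Omega> g t \<le> decr_rearr \<Omega> h t"
    proof (rule ccontr)
      assume "\<not> ?thesis"
      then have *: "decr_rearr \<Omega> h t < decr_rearr \<Omega> g t" by simp
      \<comment> \<open>Testing at the level \<open>decr_rearr \<Omega> h t\<close> itself gives the
        absurd \<open>decr_rearr \<Omega> h t < decr_rearr \<Omega> h t\<close>.\<close>
      have "ennreal t < distrib_fun \<Omega> g (decr_rearr \<Omega> h t)"
        using less_decr_rearr_iff[OF g gfin t(2) h'(3)[OF t(1)]] * by simp
      also have "\<dots> \<le> distrib_fun \<Omega> h (decr_rearr \<Omega> h t)" by (rule le)
      finally show False
        using less_decr_rearr_iff[OF in_L0[OF h] distrib_fun_finite[OF h] t(2) h'(3)[OF t(1)]] by simp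
    qed
    then show "\<bar>decr_rearr \<Omega> g t\<bar> \<le> \<bar>decr_rearr \<Omega> h t\<bar>" using g'(3)[OF t(1)] by simp
  qed
  with g'(1) decr_rearr_in[OF h]
  have *: "decr_rearr \<Omega> g \<in> X" "nrm (decr_rearr \<Omega> g) \<le> nrm h"
    using ideal_in norm_le by metis+
  show "g \<in> X" using *(1) g g'(2) by (auto intro: equi_in)
  show "nrm g \<le> nrm h" using * g g'(2) equi_norm[OF *(1) g] by simp
qed

section \<open>Order continuous elements and the distance to them\<close>

lemma Xa_in: "g \<in> Xa \<Longrightarrow> g \<in> X"
  by (simp add: order_cont_part_def)

text \<open>Ensures that the infimum in \<open>dist_Xa\<close> is over a nonempty set.\<close>

lemma zero_in_Xa: "(\<lambda>x. 0) \<in> Xa"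
  unfolding order_cont_part_def
proof (intro CollectI conjI allI impI zero_in; elim conjE)
  fix fs :: "nat \<Rightarrow> real \<Rightarrow> real"
  assume fs: "\<forall>n. fs n \<in> L0 \<Omega>"
    "AE x in Leb \<Omega>. \<forall>n. 0 \<le> fs n x \<and> fs n x \<le> \<bar>0\<bar> \<and> fs (Suc n) x \<le> fs n x"
  have "nrm (fs n) = 0" for n
  proof -
    have *: "AE x in Leb \<Omega>. \<bar>fs n x\<bar> = \<bar>0\<bar>" using fs(2) by eventually_elim (auto intro: antisym)
    have "nrm (fs n) = nrm (\<lambda>x. 0)"
      using fs(1) by (intro norm_cong zero_in *) auto
    also have "\<dots> = 0" using norm_eq_0[OF zero_in] by simp
    finally show ?thesis .
  qed
  then show "(\<lambda>n. nrm (fs n)) \<longlonglongrightarrow> 0" by simp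
qed

text \<open>Order continuity is tested on \<open>\<bar>g x\<bar> * indicator (E n) x\<close>, which
  decreases to 0 because every point eventually leaves \<open>E n\<close>.\<close>

lemma Xa_restrict_tendsto_0:
  assumes g: "g \<in> Xa" and E: "\<And>n. E n \<in> sets (Leb \<Omega>)" "decseq E" "(\<Inter>n. E n) = {}"
  shows "(\<lambda>n. nrm (\<lambda>x. g x * indicator (E n) x)) \<longlonglongrightarrow> 0"
proof -
  have gX: "g \<in> X" by (rule Xa_in[OF g])
  have absg: "(\<lambda>x. \<bar>g x\<bar>) \<in> L0 \<Omega>" using in_L0[OF gX] by (simp add: L0_def)
  define fs where "fs n x = \<bar>g x\<bar> * indicator (E n) x" for n x
  have L: "fs n \<in> L0 \<Omega>" for n
    unfolding fs_def using mult_indicator_L0[OF absg E(1)] .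
  have "(\<lambda>n. fs n x) \<longlonglongrightarrow> 0" for x
  proof -
    obtain N where "x \<notin> E N" using E(3) by blast
    then have "x \<notin> E n" if "n \<ge> N" for n using E(2) that by (auto simp: decseq_def)
    then have "eventually (\<lambda>n. fs n x = 0) sequentially"
      unfolding eventually_sequentially fs_def by fastforce
    then show ?thesis by (rule tendsto_eventually)
  qed
  moreover have "0 \<le> fs n x \<and> fs n x \<le> \<bar>g x\<bar> \<and> fs (Suc n) x \<le> fs n x" for n x
    using decseq_SucD[OF E(2), of n] by (auto simp: fs_def indicator_def)
  ultimately have "(\<lambda>n. nrm (fs n)) \<longlonglongrightarrow> 0"
    using g L unfolding order_cont_part_def by simp
  moreover have "nrm (fs n) = nrm (\<lambda>x. g x * indicator (E n) x)" for n
    by (intro norm_cong L mult_indicator_in gX E AE_I2) (simp add: fs_def abs_mult)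
  ultimately show ?thesis by simp
qed

lemma dist_Xa_le: "h \<in> X \<Longrightarrow> g \<in> Xa \<Longrightarrow> dist_Xa \<Omega> X nrm h \<le> nrm (\<lambda>x. h x - g x)"
  unfolding dist_Xa_def
  by (intro cInf_lower bdd_belowI[of _ 0]) (auto intro!: norm_nonneg diff_in intro: Xa_in)

lemma le_dist_Xa:
  assumes "\<And>g. g \<in> Xa \<Longrightarrow> r \<le> nrm (\<lambda>x. h x - g x)"
  shows "r \<le> dist_Xa \<Omega> X nrm h"
  unfolding dist_Xa_def using zero_in_Xa assms by (intro cInf_greatest) auto

text \<open>A set of positive measure has a point all of whose neighbourhoods meet it in positive
  measure; shrinking neighbourhoods of such a point yield indicators of arbitrarily small norm.\<close>
lemma indicator_norm_small:
  assumes g: "g \<in> Xa" and g0: "\<not> (AE x in Leb \<Omega>. g x = 0)" and e: "0 < e"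
  shows "\<exists>d>0. \<forall>A\<in>sets (Leb \<Omega>). emeasure (Leb \<Omega>) A < d \<longrightarrow> indicator A \<in> X \<and> nrm (indicator A) < e"
proof -
  have gL: "g \<in> L0 \<Omega>" by (intro in_L0 Xa_in g)
  define B where "B k = {x \<in> \<Omega>. 1 / real (Suc k) < \<bar>g x\<bar>}" for k
  have B_sets: "B k \<in> sets (Leb \<Omega>)" for k unfolding B_def by (rule L0_sets[OF gL])
  have "\<exists>k. B k \<notin> null_sets (Leb \<Omega>)"
  proof (rule ccontr)
    assume "\<not> ?thesis"
    then have "(\<Union>k. B k) \<in> null_sets (Leb \<Omega>)" by auto
    then have "AE x in Leb \<Omega>. x \<notin> (\<Union>k. B k)" by (rule AE_not_in)
    moreover have "x \<in> (\<Union>k. B k)" if "x \<in> \<Omega>" "g x \<noteq> 0" for x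
      using nat_approx_posE[of "\<bar>g x\<bar>"] that by (auto simp: B_def)
    ultimately have "AE x in Leb \<Omega>. g x = 0"
      by (smt (verit) AE_I2 AE_mp space_Leb)
    then show False using g0 by simp
  qed
  then obtain k where k: "B k \<notin> null_sets (Leb \<Omega>)" by blast
  define \<delta> where "\<delta> = 1 / real (Suc k)"
  have \<delta>: "0 < \<delta>" by (simp add: \<delta>_def)
  have "\<not> negligible (B k)"
    using k B_sets[of k] Omega_sets
    by (auto simp: negligible_iff_null_sets null_sets_restrict_space B_def)
  then obtain p where p: "p \<in> B k"
    "\<And>U. openin (top_of_set (B k)) U \<Longrightarrow> p \<in> U \<Longrightarrow> \<not> negligible U"
    by (subst (asm) locally_negligible_alt) blast
  \<comment> \<open>Removing \<open>p\<close> makes the intersection of the neighbourhoods empty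
    and, a point being negligible, leaves positive measure.\<close>
  define E where "E n = (B k \<inter> ball p (1 / real (Suc n))) - {p}" for n
  have E_sets: "E n \<in> sets (Leb \<Omega>)" for n
  proof -
    have "B k \<in> sets lebesgue" "B k \<subseteq> \<Omega>"
      using B_sets[of k] Omega_sets by (auto simp: sets_restrict_space_iff)
    then show ?thesis using Omega_sets unfolding E_def
      by (subst sets_restrict_space_iff) (auto intro!: sets.Diff sets.Int)
  qed
  have "1 / real (Suc n) \<le> 1 / real (Suc m)" if "m \<le> n" for m n
    using that by (simp add: frac_le)
  then have dec: "decseq E" unfolding E_def decseq_def by fastforce
  have "\<exists>n. x \<notin> E n" for x
  proof (cases "x = p")
    case False
    then obtain n where "1 / real (Suc n) < dist p x"
      using nat_approx_posE[of "dist p x"] by auto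
    then have "x \<notin> E n" by (auto simp: E_def)
    then show ?thesis by blast
  qed (auto simp: E_def)
  then have "(\<Inter>n. E n) = {}" by blast
  from Xa_restrict_tendsto_0[OF g E_sets dec this]
  have lim: "(\<lambda>n. nrm (\<lambda>x. g x * indicator (E n) x)) \<longlonglongrightarrow> 0" .
  have "0 < \<delta> * e" using \<delta> e by simp
  from order_tendstoD(2)[OF lim this] obtain n where n: "nrm (\<lambda>x. g x * indicator (E n) x) < \<delta> * e"
    by (auto simp: eventually_sequentially)
  \<comment> \<open>On \<open>E n\<close> the values of \<open>\<bar>g x\<bar>\<close> are at least
    \<open>\<delta>\<close>, so dividing by \<open>\<delta>\<close> dominates the indicator.\<close>
  let ?g = "\<lambda>x. inverse \<delta> * (g x * indicator (E n) x)"
  have gE: "(\<lambda>x. g x * indicator (E n) x) \<in> X" by (intro mult_indicator_in Xa_in g E_sets)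
  have "AE x in Leb \<Omega>. \<bar>indicator (E n) x\<bar> \<le> \<bar>?g x\<bar>"
  proof (rule AE_I2)
    fix x
    have "\<delta> \<le> \<bar>g x\<bar>" if "x \<in> E n" using that by (simp add: E_def B_def \<delta>_def)
    then show "\<bar>indicator (E n) x\<bar> \<le> \<bar>?g x\<bar>"
      using \<delta> by (auto simp: indicator_def abs_mult divide_simps)
  qed
  then have "indicator (E n) \<in> X" "nrm (indicator (E n)) \<le> nrm ?g"
    using indicator_L0[OF E_sets] scale_in[OF gE] ideal_in norm_le by blast+
  moreover have "nrm ?g < e"
    using n \<delta> by (subst norm_scale[OF gE]) (simp add: field_simps)
  ultimately have En: "indicator (E n) \<in> X" "nrm (indicator (E n)) < e" by auto
  have "\<not> negligible (E n)"
  proof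
    assume "negligible (E n)"
    then have "negligible (insert p (E n))" by (simp add: negligible_insert)
    moreover have "insert p (E n) = B k \<inter> ball p (1 / real (Suc n))"
      using p(1) by (auto simp: E_def)
    moreover have "\<not> negligible (B k \<inter> ball p (1 / real (Suc n)))"
      using p(1) by (intro p(2) openin_open_Int) auto
    ultimately show False by simp
  qed
  then have pos: "0 < emeasure (Leb \<Omega>) (E n)"
    using E_sets[of n] Omega_sets
    by (auto simp: negligible_iff_null_sets null_sets_def emeasure_restrict_space
        sets_restrict_space_iff zero_less_iff_neq_zero)
  \<comment> \<open>The measure of \<open>E n\<close> serves as \<open>d\<close>: a set of smaller
    measure has an indicator with smaller distribution function.\<close>
  have "indicator A \<in> X \<and> nrm (indicator A) < e"
    if A: "A \<in> sets (Leb \<Omega>)" "emeasure (Leb \<Omega>) A < emeasure (Leb \<Omega>) (E n)" for A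
  proof -
    have "A \<subseteq> \<Omega>" "E n \<subseteq> \<Omega>" using A(1) E_sets[of n] sets.sets_into_space space_Leb by metis+
    then have "distrib_fun \<Omega> (indicator A) s \<le> distrib_fun \<Omega> (indicator (E n)) s" for s
      using A(2) by (auto simp: distrib_fun_indicator)
    from distrib_fun_mono[OF En(1) indicator_L0[OF A(1)] this]
    show ?thesis using En(2) by simp
  qed
  then show ?thesis using pos by blast
qed

text \<open>The difference is bounded by \<open>b\<close> and supported on a set \<open>A\<close> of
  finite measure. A sequence below it that decreases to 0 is at most \<open>\<eta>\<close> on
  \<open>A\<close> outside a set \<open>D n\<close> whose measure tends to 0, and
  \<open>small\<close> controls the contribution of \<open>D n\<close>.\<close>

lemma bounded_part_in_Xa:
  assumes small: "\<And>e. 0 < e \<Longrightarrow>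
      \<exists>d>0. \<forall>A\<in>sets (Leb \<Omega>). emeasure (Leb \<Omega>) A < d \<longrightarrow> indicator A \<in> X \<and> nrm (indicator A) < e"
    and h: "h \<in> X" and ab: "0 < a" "0 < b" and fin: "distrib_fun \<Omega> h a < \<infinity>"
  shows "(\<lambda>x. h x - cut a b h x) \<in> Xa"
proof -
  define A where "A = {x \<in> \<Omega>. a < \<bar>h x\<bar> \<and> \<bar>h x\<bar> \<le> b}"
  define w where "w = (\<lambda>x. h x - cut a b h x)"
  have hL [measurable]: "h \<in> borel_measurable (Leb \<Omega>)" using in_L0[OF h] by (simp add: L0_def)
  have "{x \<in> space (Leb \<Omega>). a < \<bar>h x\<bar> \<and> \<bar>h x\<bar> \<le> b} \<in> sets (Leb \<Omega>)" by measurable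
  then have A [measurable]: "A \<in> sets (Leb \<Omega>)" by (simp add: A_def)
  have wL: "w \<in> L0 \<Omega>"
    using cut_L0[OF in_L0[OF h], of a b] unfolding w_def L0_def by measurable
  have "AE x in Leb \<Omega>. \<bar>w x\<bar> \<le> \<bar>h x\<bar>" by (rule AE_I2) (auto simp: w_def cut_def)
  then have w: "w \<in> X" using ideal_in wL h by blast
  have w_le: "\<bar>w x\<bar> \<le> b * indicator A x" if "x \<in> \<Omega>" for x
    using that by (auto simp: w_def cut_def A_def)
  have "AE x in Leb \<Omega>. \<bar>indicator A x\<bar> \<le> \<bar>inverse a * h x\<bar>"
    using ab by (intro AE_I2) (auto simp: A_def indicator_def abs_mult divide_simps)
  then have indA: "indicator A \<in> X"
    using indicator_L0[OF A] scale_in[OF h] ideal_in by blast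
  have "emeasure (Leb \<Omega>) A \<le> distrib_fun \<Omega> h a"
    unfolding distrib_fun_def using L0_sets[OF in_L0[OF h]] by (intro emeasure_mono) (auto simp: A_def)
  then have finA: "emeasure (Leb \<Omega>) A < \<infinity>" using fin by (rule le_less_trans)
  have "(\<lambda>n. nrm (fs n)) \<longlonglongrightarrow> 0"
    if fs: "\<And>n. fs n \<in> L0 \<Omega>"
      and mono: "AE x in Leb \<Omega>. \<forall>n. 0 \<le> fs n x \<and> fs n x \<le> \<bar>w x\<bar> \<and> fs (Suc n) x \<le> fs n x"
      and lim: "AE x in Leb \<Omega>. (\<lambda>n. fs n x) \<longlonglongrightarrow> 0" for fs :: "nat \<Rightarrow> real \<Rightarrow> real"
  proof (rule LIMSEQ_I)
    fix e :: real assume e: "0 < e"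
    have [measurable]: "fs n \<in> borel_measurable (Leb \<Omega>)" for n using fs[of n] by (simp add: L0_def)
    have fs_le: "AE x in Leb \<Omega>. 0 \<le> fs n x \<and> fs n x \<le> \<bar>w x\<bar>" for n
      using mono by eventually_elim auto
    have "AE x in Leb \<Omega>. \<bar>fs n x\<bar> \<le> \<bar>w x\<bar>" for n
      using fs_le[of n] by eventually_elim simp
    then have fsX: "fs n \<in> X" for n using fs w ideal_in by blast
    \<comment> \<open>Adding 1 keeps \<open>K\<close> positive and makes
      \<open>\<eta> * nrm (indicator A)\<close> strictly less than \<open>e / 2\<close>.\<close>
    define K where "K = nrm (indicator A) + 1"
    have K: "0 < K" using norm_nonneg[OF indA] by (simp add: K_def)
    define \<eta> where "\<eta> = e / (2 * K)"
    have \<eta>: "0 < \<eta>" using e K by (simp add: \<eta>_def)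
    \<comment> \<open>The union over all later indices makes \<open>D\<close> decreasing at every
      point, although \<open>fs\<close> decreases only almost everywhere.\<close>
    define D where "D n = (\<Union>m\<in>{n..}. {x \<in> space (Leb \<Omega>). x \<in> A \<and> \<eta> < fs m x})" for n
    have D: "D n \<in> sets (Leb \<Omega>)" for n unfolding D_def by measurable
    have "(\<lambda>n. emeasure (Leb \<Omega>) (D n)) \<longlonglongrightarrow> emeasure (Leb \<Omega>) (\<Inter>n. D n)"
    proof (rule Lim_emeasure_decseq)
      show "range D \<subseteq> sets (Leb \<Omega>)" using D by auto
      show "decseq D" unfolding decseq_def D_def by fastforce
      fix n
      have "emeasure (Leb \<Omega>) (D n) \<le> emeasure (Leb \<Omega>) A"
        using A by (intro emeasure_mono) (auto simp: D_def)
      then show "emeasure (Leb \<Omega>) (D n) \<noteq> \<infinity>" using finA by auto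
    qed
    moreover have "emeasure (Leb \<Omega>) (\<Inter>n. D n) = 0"
    proof -
      have "AE x in Leb \<Omega>. x \<notin> (\<Inter>n. D n)"
        using lim
      proof eventually_elim
        fix x assume "(\<lambda>n. fs n x) \<longlonglongrightarrow> 0"
        from order_tendstoD(2)[OF this \<eta>] obtain N where "\<And>m. m \<ge> N \<Longrightarrow> fs m x < \<eta>"
          by (auto simp: eventually_sequentially)
        then have "x \<notin> D N" unfolding D_def by fastforce
        then show "x \<notin> (\<Inter>n. D n)" by blast
      qed
      moreover have "(\<Inter>n. D n) \<in> sets (Leb \<Omega>)" using D by auto
      moreover have "{x \<in> space (Leb \<Omega>). \<not> x \<notin> (\<Inter>n. D n)} = (\<Inter>n. D n)"
        by (auto simp: D_def)
      ultimately show ?thesis by (subst (asm) AE_iff_measurable) auto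
    qed
    ultimately have Dlim: "(\<lambda>n. emeasure (Leb \<Omega>) (D n)) \<longlonglongrightarrow> 0" by simp
    obtain d where d: "0 < d" "\<And>B. B \<in> sets (Leb \<Omega>) \<Longrightarrow> emeasure (Leb \<Omega>) B < d
        \<Longrightarrow> indicator B \<in> X \<and> nrm (indicator B) < e / (2 * b)"
      using small[of "e / (2 * b)"] e ab by auto
    obtain N where N: "\<And>n. n \<ge> N \<Longrightarrow> emeasure (Leb \<Omega>) (D n) < d"
      using order_tendstoD(2)[OF Dlim d(1)] by (auto simp: eventually_sequentially)
    have "norm (nrm (fs n) - 0) < e" if "n \<ge> N" for n
    proof -
      have Dn: "indicator (D n) \<in> X" "nrm (indicator (D n)) < e / (2 * b)"
        using d(2)[OF D N[OF that]] by auto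
      let ?u = "\<lambda>x. \<eta> * indicator A x + b * indicator (D n) x"
      have "AE x in Leb \<Omega>. \<bar>fs n x\<bar> \<le> \<bar>?u x\<bar>"
        using fs_le[of n] AE_space
      proof eventually_elim
        case (elim x)
        then have x: "x \<in> \<Omega>" "0 \<le> fs n x" "fs n x \<le> b * indicator A x"
          using w_le[of x] by auto
        show ?case
        proof (cases "x \<in> D n")
          case True
          then show ?thesis using x \<eta> ab by (auto simp: indicator_def split: if_splits)
        next
          case False
          then have "x \<in> A \<Longrightarrow> fs n x \<le> \<eta>" using x by (force simp: D_def)
          then show ?thesis using x False \<eta> by (auto simp: indicator_def split: if_splits)
        qed
      qed
      then have "nrm (fs n) \<le> nrm ?u"
        using fs indA Dn(1) by (intro norm_le add_in scale_in)
      also have "\<dots> \<le> \<eta> * nrm (indicator A) + b * nrm (indicator (D n))"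
        using norm_triangle[OF scale_in[OF indA] scale_in[OF Dn(1)], of \<eta> b] \<eta> ab
        by (simp add: norm_scale[OF indA] norm_scale[OF Dn(1)])
      also have "\<eta> * nrm (indicator A) < e / 2"
      proof -
        have "\<eta> * nrm (indicator A) < \<eta> * K" using \<eta> by (simp add: K_def)
        also have "\<dots> = e / 2" using K by (simp add: \<eta>_def)
        finally show ?thesis .
      qed
      also have "b * nrm (indicator (D n)) < e / 2"
        using Dn(2) ab by (simp add: field_simps)
      finally show ?thesis using norm_nonneg[OF fsX[of n]] by simp
    qed
    then show "\<exists>no. \<forall>n\<ge>no. norm (nrm (fs n) - 0) < e" by blast
  qed
  then have "w \<in> Xa" using w unfolding order_cont_part_def by blast
  then show ?thesis by (simp add: w_def)
qed

section \<open>Bounding truncations of \<open>h\<close> by the distance of \<open>h\<close> to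
  \<open>Xa\<close>\<close>

lemma cut_in:
  assumes h: "h \<in> X"
  shows "cut a b h \<in> X"
proof -
  have "AE x in Leb \<Omega>. \<bar>cut a b h x\<bar> \<le> \<bar>h x\<bar>" by (rule AE_I2) (auto simp: cut_def)
  then show ?thesis using h cut_L0[OF in_L0[OF h]] ideal_in by blast
qed

text \<open>When every positive level has finite measure, all levels \<open>1 / real (Suc n)\<close>
  and \<open>real (Suc n)\<close> are admissible. The truncations are restrictions of
  \<open>h\<close> to sets \<open>E n\<close> decreasing to the empty set, so
  \<open>norm_restrict_le\<close> applies.\<close>

lemma cut_norm_le_finite:
  assumes h: "h \<in> X" and g: "g \<in> Xa" and e: "0 < e"
    and fin: "\<And>a. 0 < a \<Longrightarrow> distrib_fun \<Omega> h a < \<infinity>"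
  shows "\<exists>a b. 0 < a \<and> a \<le> b \<and> distrib_fun \<Omega> h a < \<infinity> \<and>
    nrm (cut a b h) \<le> nrm (\<lambda>x. h x - g x) + e"
proof -
  \<comment> \<open>Zeros of \<open>h\<close> are excluded because they would lie in every
    \<open>E n\<close>.\<close>
  define E where "E n = {x \<in> space (Leb \<Omega>).
    h x \<noteq> 0 \<and> \<not> (1 / real (Suc n) < \<bar>h x\<bar> \<and> \<bar>h x\<bar> \<le> real (Suc n))}" for n
  have hL [measurable]: "h \<in> borel_measurable (Leb \<Omega>)" using in_L0[OF h] by (simp add: L0_def)
  have E: "E n \<in> sets (Leb \<Omega>)" for n unfolding E_def by measurable
  have "1 / real (Suc n) \<le> 1 / real (Suc m)" if "m \<le> n" for m n
    using that by (simp add: frac_le)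
  then have dec: "decseq E" unfolding decseq_def E_def by fastforce
  have "\<exists>n. x \<notin> E n" for x
  proof (cases "h x = 0")
    case False
    then obtain m where m: "1 / real (Suc m) < \<bar>h x\<bar>"
      using nat_approx_posE[of "\<bar>h x\<bar>"] by auto
    obtain k where k: "\<bar>h x\<bar> \<le> real k" using real_arch_simple by blast
    have "1 / real (Suc (max m k)) \<le> 1 / real (Suc m)" by (simp add: frac_le)
    then have "x \<notin> E (max m k)" using m k by (auto simp: E_def)
    then show ?thesis by blast
  qed (auto simp: E_def)
  then have "(\<Inter>n. E n) = {}" by blast
  from order_tendstoD(2)[OF Xa_restrict_tendsto_0[OF g E dec this] e]
  obtain n where n: "nrm (\<lambda>x. g x * indicator (E n) x) < e"
    by (auto simp: eventually_sequentially)
  have "nrm (cut (1 / real (Suc n)) (real (Suc n)) h) = nrm (\<lambda>x. h x * indicator (E n) x)"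
    using h by (intro norm_cong AE_I2 cut_L0 in_L0 mult_indicator_in E)
      (auto simp: E_def cut_def indicator_def)
  also have "\<dots> \<le> nrm (\<lambda>x. h x - g x) + nrm (\<lambda>x. g x * indicator (E n) x)"
    by (intro norm_restrict_le h Xa_in g E)
  also have "\<dots> \<le> nrm (\<lambda>x. h x - g x) + e" using n by simp
  finally have "nrm (cut (1 / real (Suc n)) (real (Suc n)) h) \<le> nrm (\<lambda>x. h x - g x) + e" .
  moreover have "1 / real (Suc n) \<le> real (Suc n)"
    by (rule order_trans[of _ 1]) auto
  moreover have pos: "0 < 1 / real (Suc n)" by simp
  ultimately show ?thesis
    using fin[OF pos] by metis
qed

text \<open>Let \<open>c\<close> be the limit of \<open>h\<^sup>*\<close> at infinity. Up to the small constant \<open>\<eta>\<close>, the function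
  \<open>cut (c + \<eta>) k h\<close> is dominated by \<open>u\<close>, which equals \<open>\<bar>h\<bar>\<close> where \<open>\<bar>h\<bar> > k\<close> and \<open>c\<close> elsewhere.
  The restriction of \<open>h\<close> to \<open>{\<bar>h\<bar> > k} \<union> {x > k}\<close> has a larger distribution function than \<open>u\<close>,
  because \<open>{x > k}\<close> still contains an infinite part of every level set below \<open>c\<close>.\<close>
lemma cut_norm_le_infinite:
  assumes h: "h \<in> X" and g: "g \<in> Xa" and e: "0 < e"
    and s0: "0 < s0" "distrib_fun \<Omega> h s0 = \<infinity>"
  shows "\<exists>a b. 0 < a \<and> a \<le> b \<and> distrib_fun \<Omega> h a < \<infinity> \<and>
    nrm (cut a b h) \<le> nrm (\<lambda>x. h x - g x) + e"
proof -
  note hL = in_L0[OF h]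
  have hM [measurable]: "h \<in> borel_measurable (Leb \<Omega>)" using hL by (simp add: L0_def)
  note idM [measurable] = id_measurable
  \<comment> \<open>The limit \<open>c\<close> appears as a critical level: the distribution
    function is infinite below it and finite above it.\<close>
  define S where "S = {s. distrib_fun \<Omega> h s < \<infinity>}"
  define c where "c = Inf S"
  have S_ge: "s0 \<le> s" if "s \<in> S" for s
  proof (rule ccontr)
    assume "\<not> s0 \<le> s"
    then have "\<infinity> \<le> distrib_fun \<Omega> h s" using distrib_fun_antimono[OF hL, of s s0] s0 by simp
    then show False using that by (simp add: S_def top_unique)
  qed
  have S_ne: "S \<noteq> {}" using distrib_fun_finite[OF h] by (auto simp: S_def)
  have bdd: "bdd_below S" using S_ge by (rule bdd_belowI)
  have c: "0 < c" using cInf_greatest[OF S_ne S_ge] s0 by (auto simp: c_def)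
  have inf_below: "distrib_fun \<Omega> h s = \<infinity>" if "s < c" for s
  proof (rule ccontr)
    assume "\<not> ?thesis"
    then have "s \<in> S" by (simp add: S_def less_top)
    then have "c \<le> s" unfolding c_def using bdd by (rule cInf_lower)
    then show False using that by simp
  qed
  have fin_above: "distrib_fun \<Omega> h s < \<infinity>" if "c < s" for s
  proof -
    obtain s' where "s' \<in> S" "s' < s" using \<open>c < s\<close> cInf_lessD[OF S_ne] by (auto simp: c_def)
    then show ?thesis using distrib_fun_antimono[OF hL, of s' s] by (auto simp: S_def intro: le_less_trans)
  qed
  \<comment> \<open>Below level 1, the function \<open>inverse s0 * h x\<close> has infinite
    distribution function, so it dominates the constant 1 in distribution.\<close>
  have one: "(\<lambda>x. 1) \<in> X"
  proof (rule distrib_fun_mono(1))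
    show "(\<lambda>x. inverse s0 * h x) \<in> X" using h by (rule scale_in)
    show "(\<lambda>x. 1) \<in> L0 \<Omega>" by (simp add: L0_def)
    fix s :: real
    show "distrib_fun \<Omega> (\<lambda>x. 1) s \<le> distrib_fun \<Omega> (\<lambda>x. inverse s0 * h x) s"
    proof (cases "s < 1")
      case True
      then have "s0 * s \<le> s0" using s0 by simp
      then have "\<infinity> \<le> distrib_fun \<Omega> h (s0 * s)"
        using distrib_fun_antimono[OF hL, of "s0 * s" s0] s0(2) by simp
      then show ?thesis using s0
        by (subst distrib_fun_scale) (auto simp: divide_inverse mult.commute top_unique)
    next
      case False
      then show ?thesis by (simp add: distrib_fun_def)
    qed
  qed
  define K where "K = nrm (\<lambda>x. 1) + 1"
  have K: "0 < K" using norm_nonneg[OF one] by (simp add: K_def)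
  define \<eta> where "\<eta> = e / (2 * K)"
  have \<eta>: "0 < \<eta>" using e K by (simp add: \<eta>_def)
  define F where "F k = {x \<in> space (Leb \<Omega>). real k < \<bar>h x\<bar> \<or> real k < x}" for k
  have F: "F k \<in> sets (Leb \<Omega>)" for k unfolding F_def by measurable
  have dec: "decseq F" unfolding decseq_def F_def by fastforce
  have "\<exists>k. x \<notin> F k" for x
  proof -
    obtain k where "max x \<bar>h x\<bar> \<le> real k" using real_arch_simple by blast
    then have "x \<notin> F k" by (auto simp: F_def)
    then show ?thesis by blast
  qed
  then have "(\<Inter>k. F k) = {}" by blast
  from order_tendstoD(2)[OF Xa_restrict_tendsto_0[OF g F dec this], of "e / 2"] e
  obtain N where N: "\<And>k. k \<ge> N \<Longrightarrow> nrm (\<lambda>x. g x * indicator (F k) x) < e / 2"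
    by (auto simp: eventually_sequentially)
  obtain k0 where "c + \<eta> \<le> real k0" using real_arch_simple by blast
  define k where "k = max N k0"
  have k: "c + \<eta> \<le> real k" "nrm (\<lambda>x. g x * indicator (F k) x) < e / 2"
    using \<open>c + \<eta> \<le> real k0\<close> N[of k] by (auto simp: k_def)
  define u where "u x = (if real k < \<bar>h x\<bar> then \<bar>h x\<bar> else c)" for x
  have uL: "u \<in> L0 \<Omega>" unfolding L0_def u_def by measurable
  have hF: "(\<lambda>x. h x * indicator (F k) x) \<in> X" by (intro mult_indicator_in h F)
  have u_le: "distrib_fun \<Omega> u s \<le> distrib_fun \<Omega> (\<lambda>x. h x * indicator (F k) x) s" for s
  proof (cases "s < c")
    case True
    let ?R = "{x \<in> \<Omega>. s < \<bar>h x * indicator (F k) x\<bar>}"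
    have R: "?R \<in> sets (Leb \<Omega>)" by (rule L0_sets[OF in_L0[OF hF]])
    have I: "{x \<in> space (Leb \<Omega>). x \<le> real k} \<in> sets (Leb \<Omega>)" by measurable
    have "emeasure (Leb \<Omega>) {x \<in> space (Leb \<Omega>). x \<le> real k} \<le> emeasure lebesgue {0..real k}"
    proof -
      have "{x \<in> space (Leb \<Omega>). x \<le> real k} \<subseteq> {0..real k}" "space (Leb \<Omega>) = \<Omega>"
        using Omega by auto
      then show ?thesis
        using Omega_sets
        by (subst emeasure_restrict_space) (auto intro!: emeasure_mono simp del: emeasure_completion)
    qed
    then have Ifin: "emeasure (Leb \<Omega>) {x \<in> space (Leb \<Omega>). x \<le> real k} < \<infinity>"
      by (rule le_less_trans) simp
    have "\<infinity> = emeasure (Leb \<Omega>) {x \<in> \<Omega>. s < \<bar>h x\<bar>}"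
      using inf_below[OF True] by (simp add: distrib_fun_def)
    also have "\<dots> \<le> emeasure (Leb \<Omega>) (?R \<union> {x \<in> space (Leb \<Omega>). x \<le> real k})"
    proof (rule emeasure_mono)
      show "{x \<in> \<Omega>. s < \<bar>h x\<bar>} \<subseteq> ?R \<union> {x \<in> space (Leb \<Omega>). x \<le> real k}"
        by (auto simp: F_def)
      show "?R \<union> {x \<in> space (Leb \<Omega>). x \<le> real k} \<in> sets (Leb \<Omega>)"
        using R I by (rule sets.Un)
    qed
    also have "\<dots> \<le> emeasure (Leb \<Omega>) ?R + emeasure (Leb \<Omega>) {x \<in> space (Leb \<Omega>). x \<le> real k}"
      using R I by (rule emeasure_subadditive)
    finally have "emeasure (Leb \<Omega>) ?R = \<infinity>"
      using Ifin by (auto simp: top_unique ennreal_add_eq_top)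
    then show ?thesis by (simp add: distrib_fun_def)
  next
    case False
    \<comment> \<open>At or above \<open>c\<close>, \<open>u\<close> exceeds \<open>s\<close> only
      where \<open>\<bar>h x\<bar> > k\<close>, which lies in \<open>F k\<close> and where
      \<open>u\<close> equals \<open>\<bar>h x\<bar>\<close>.\<close>
    then have "{x \<in> \<Omega>. s < \<bar>u x\<bar>} \<subseteq> {x \<in> \<Omega>. s < \<bar>h x * indicator (F k) x\<bar>}"
      using c by (auto simp: u_def F_def indicator_def split: if_splits)
    then show ?thesis unfolding distrib_fun_def
      using L0_sets[OF in_L0[OF hF]] by (intro emeasure_mono)
  qed
  note u = distrib_fun_mono[OF hF uL u_le]
  have \<eta>1: "(\<lambda>x. \<eta> * 1) \<in> X" by (rule scale_in[OF one])
  \<comment> \<open>Where \<open>\<bar>h x\<bar> \<le> k\<close>, the truncation keeps only values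
    of modulus at most \<open>c + \<eta>\<close>; elsewhere its modulus is
    \<open>u x\<close>.\<close>
  have "nrm (cut (c + \<eta>) (real k) h) \<le> nrm (\<lambda>x. u x + \<eta> * 1)"
    using \<eta> c k(1)
    by (intro norm_le cut_L0 hL add_in u \<eta>1 AE_I2) (auto simp: cut_def u_def)
  also have "\<dots> \<le> nrm u + \<eta> * nrm (\<lambda>x. 1)"
    using norm_triangle[OF u(1) \<eta>1] norm_scale[OF one, of \<eta>] \<eta> by simp
  also have "\<eta> * nrm (\<lambda>x. 1) \<le> \<eta> * K" using \<eta> by (simp add: K_def)
  also have "\<eta> * K = e / 2" using K by (simp add: \<eta>_def)
  also have "nrm u \<le> nrm (\<lambda>x. h x - g x) + nrm (\<lambda>x. g x * indicator (F k) x)"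
    using u(2) norm_restrict_le[OF h Xa_in[OF g] F[of k]] by simp
  finally have "nrm (cut (c + \<eta>) (real k) h) \<le> nrm (\<lambda>x. h x - g x) + e"
    using k(2) by simp
  moreover have "0 < c + \<eta>" "distrib_fun \<Omega> h (c + \<eta>) < \<infinity>"
    using c \<eta> fin_above[of "c + \<eta>"] by auto
  ultimately show ?thesis using k(1) by metis
qed

section \<open>Comparison of distances for equimeasurable functions\<close>

text \<open>Each competitor \<open>g\<close> for \<open>h\<close> yields levels at which the
  truncation of \<open>h\<close> has norm at most \<open>nrm (\<lambda>x. h x - g x) + e\<close>.
  Removing the same layer from \<open>f\<close> leaves a function of equal norm, and the removed
  part is a competitor for \<open>f\<close>. The hypotheses are symmetric in \<open>f\<close> and
  \<open>h\<close>, so equality follows by exchanging them.\<close>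

lemma dist_Xa_equimeasurable_le:
  assumes f: "f \<in> X" and h: "h \<in> X" and eq: "distrib_fun \<Omega> f = distrib_fun \<Omega> h"
  shows "dist_Xa \<Omega> X nrm f \<le> dist_Xa \<Omega> X nrm h"
proof (rule le_dist_Xa)
  fix g assume g: "g \<in> Xa"
  show "dist_Xa \<Omega> X nrm f \<le> nrm (\<lambda>x. h x - g x)"
  proof (cases "\<forall>\<gamma>\<in>Xa. AE x in Leb \<Omega>. \<gamma> x = 0")
    \<comment> \<open>If \<open>Xa\<close> is trivial, the distance reduces to the norm, which is
      rearrangement invariant.\<close>
    case True
    then have "AE x in Leb \<Omega>. g x = 0" using g by blast
    then have *: "AE x in Leb \<Omega>. \<bar>h x\<bar> = \<bar>h x - g x\<bar>" by eventually_elim simp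
    have "dist_Xa \<Omega> X nrm f \<le> nrm f" using dist_Xa_le[OF f zero_in_Xa] by simp
    also have "\<dots> = nrm h" by (rule equi_norm[OF h in_L0[OF f] eq])
    also have "\<dots> = nrm (\<lambda>x. h x - g x)"
      by (intro norm_cong in_L0 h diff_in Xa_in g *)
    finally show ?thesis .
  next
    case False
    then obtain \<gamma> where \<gamma>: "\<gamma> \<in> Xa" "\<not> (AE x in Leb \<Omega>. \<gamma> x = 0)" by blast
    show ?thesis
    proof (rule field_le_epsilon)
      fix e :: real assume e: "0 < e"
      have "\<exists>a b. 0 < a \<and> a \<le> b \<and> distrib_fun \<Omega> h a < \<infinity> \<and>
          nrm (cut a b h) \<le> nrm (\<lambda>x. h x - g x) + e"
      proof (cases "\<exists>s>0. distrib_fun \<Omega> h s = \<infinity>")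
        case True
        then show ?thesis using cut_norm_le_infinite[OF h g e] by blast
      next
        case False
        then have "distrib_fun \<Omega> h a < \<infinity>" if "0 < a" for a
          using that by (simp add: less_top[symmetric])
        then show ?thesis by (rule cut_norm_le_finite[OF h g e])
      qed
      then obtain a b where ab: "0 < a" "a \<le> b" "distrib_fun \<Omega> h a < \<infinity>"
        "nrm (cut a b h) \<le> nrm (\<lambda>x. h x - g x) + e"
        by blast
      \<comment> \<open>Small norms of indicators come from the nonzero element
        \<open>\<gamma>\<close>; the competitor \<open>g\<close> itself may vanish almost
        everywhere.\<close>
      have "(\<lambda>x. f x - cut a b f x) \<in> Xa"
        using ab eq by (intro bounded_part_in_Xa indicator_norm_small[OF \<gamma>] f) auto
      from dist_Xa_le[OF f this] have "dist_Xa \<Omega> X nrm f \<le> nrm (cut a b f)" by simp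
      also have "\<dots> = nrm (cut a b h)"
        using ab eq by (intro equi_norm cut_in h cut_L0 in_L0 f distrib_fun_cut_cong) auto
      finally show "dist_Xa \<Omega> X nrm f \<le> nrm (\<lambda>x. h x - g x) + e" using ab(4) by simp
    qed
  qed
qed

end

theorem theorem3p5:
  fixes \<Omega> :: "real set" and X :: "(real \<Rightarrow> real) set" and nrm :: "(real \<Rightarrow> real) \<Rightarrow> real"
    and f :: "real \<Rightarrow> real"
  assumes "\<Omega> = {0<..<1} \<or> \<Omega> = {0<..}"
    and "ri_space \<Omega> X nrm"
    and "fatou_property \<Omega> X nrm"
    and "f \<in> X"
  shows "dist_Xa \<Omega> X nrm (decr_rearr \<Omega> f) = dist_Xa \<Omega> X nrm f"
proof -
  interpret ri_function_space \<Omega> X nrm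
    using assms by unfold_locales
  note fs = decr_rearr_in(1)[OF assms(4)]
  note eq = decr_rearr_equimeasurable(2)[OF Omega in_L0 distrib_fun_finite, OF assms(4,4)]
  show ?thesis
    using dist_Xa_equimeasurable_le[OF fs assms(4) eq]
      dist_Xa_equimeasurable_le[OF assms(4) fs eq[symmetric]] by (rule antisym)
qed

end
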